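(* Let $d\ge2$ and let $\sigma_{p_c}:\mathbb{E}^d\to\{0,1\}$ be critical Bernoulli bond percolation on $\mathbb{Z}^d$: the values $\sigma_{p_c}(e)$, $e\in\mathbb{E}^d$, are independent, equal to $0$ with probability $p_c(d)$ and to $1$ with probability $1-p_c(d)$. Then $$\forall\eta>0,\quad\limsup_{R\to\infty}R^{d-1+\eta}\,\mathbb{P}[\mathrm{Cross}_0(A_R)]>0.$$
   Context: $\mathbb{E}^d$ is the set of nearest-neighbour edges of $\mathbb{Z}^d$, viewed as segments in $\mathbb{R}^d$. For $p\in[0,1]$, $\sigma_p$ denotes i.i.d. edge values equal to $0$ with probability $p$ and $1$ with probability $1-p$, and $p_c(d)=\sup\{p\in[0,1]:\text{a.s. there is no infinite connected component of }\{\sigma_p=0\}\}$. For $R>1$, $A_R=B(0,R)\setminus B(0,1)\subset\mathbb{R}^d$ (Euclidean balls), and $\mathrm{Cross}_0(A_R)$ is the event that there is a continuous path contained in the union of the edges of value $0$ crossing $A_R$, i.e. joining the spheres $S(0,1)$ and $S(0,R)$. *)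

theory Defs
  imports "HOL-Probability.Probability"
begin

text \<open>The dimension \<open>d\<close> is \<open>CARD('d)\<close>, and \<open>\<real>\<^sup>d\<close> is \<open>real ^ 'd\<close> with its Euclidean norm.\<close>

definition int_lattice :: "(real ^ 'd) set" where
  "int_lattice = {x. \<forall>i. x $ i \<in> \<int>}"

text \<open>An edge is the segment itself, so \<open>closed_segment x y\<close> and \<open>closed_segment y x\<close> are
  one and the same unoriented edge.\<close>

definition edges :: "(real ^ 'd) set set" where
  "edges = {closed_segment x y | x y. x \<in> int_lattice \<and> y \<in> int_lattice \<and> dist x y = 1}"

text \<open>The law of \<open>\<sigma>\<^sub>p\<close>. Success of the Bernoulli variable, of probability \<open>p\<close>, corresponds to
  the value \<open>0\<close>.\<close>

definition percolation :: "real \<Rightarrow> ((real ^ 'd) set \<Rightarrow> nat) measure" where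
  "percolation p =
     PiM edges (\<lambda>_. measure_pmf (map_pmf (\<lambda>b. if b then 0 else 1) (bernoulli_pmf p)))"

definition zero_edges :: "((real ^ 'd) set \<Rightarrow> nat) \<Rightarrow> (real ^ 'd) set set" where
  "zero_edges \<sigma> = {e \<in> edges. \<sigma> e = 0}"

definition zero_adj :: "((real ^ 'd) set \<Rightarrow> nat) \<Rightarrow> real ^ 'd \<Rightarrow> real ^ 'd \<Rightarrow> bool" where
  "zero_adj \<sigma> x y \<longleftrightarrow>
     x \<in> int_lattice \<and> y \<in> int_lattice \<and> dist x y = 1 \<and> closed_segment x y \<in> zero_edges \<sigma>"

text \<open>The set of vertices of the connected component of \<open>x\<close> in the graph on the lattice whose
  edges are those of value \<open>0\<close>. Each vertex has finitely many incident edges, so counting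
  vertices or edges gives the same notion of infinite component.\<close>

definition zero_component :: "((real ^ 'd) set \<Rightarrow> nat) \<Rightarrow> real ^ 'd \<Rightarrow> (real ^ 'd) set" where
  "zero_component \<sigma> x = {y. (zero_adj \<sigma>)\<^sup>*\<^sup>* x y}"

definition p_c :: "'d::finite itself \<Rightarrow> real" where
  "p_c _ = Sup {p \<in> {0..1}. AE \<sigma> in (percolation p :: ((real ^ 'd) set \<Rightarrow> nat) measure).
                 \<not> (\<exists>x \<in> int_lattice. infinite (zero_component \<sigma> x))}"

text \<open>For \<open>R > 1\<close>, the event that the annulus between the spheres of radii \<open>1\<close> and \<open>R\<close> is
  crossed. The path is not asked to stay in the annulus: a path joining the two spheres
  always has a subpath that joins them within the closed annulus.\<close>

definition Cross0 :: "real \<Rightarrow> ((real ^ 'd) set \<Rightarrow> nat) set" where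
  "Cross0 R = {\<sigma> \<in> PiE edges (\<lambda>_. UNIV). \<exists>\<gamma>. path \<gamma> \<and> path_image \<gamma> \<subseteq> \<Union> (zero_edges \<sigma>) \<and>
                 pathstart \<gamma> \<in> sphere 0 1 \<and> pathfinish \<gamma> \<in> sphere 0 R}"

lemma space_percolation: "space (percolation p) = PiE edges (\<lambda>_. UNIV)"
  by (simp add: percolation_def space_PiM)

end

theory Submission
  imports Defs
begin

text \<open>Let \<open>\<theta>\<^sub>n(p)\<close> be the probability that the origin is joined by edges of value \<open>0\<close> to a
  vertex at sup-distance at least \<open>n\<close>. Decomposing such a connection at its last visit to the box
  of radius \<open>m\<close> gives \<open>\<theta>\<^bsub>m+n\<^esub> \<le> \<bar>\<partial>B\<^sub>m\<bar> \<theta>\<^sub>m \<theta>\<^sub>n\<close>. Hence \<open>\<bar>\<partial>B\<^sub>m\<bar> \<theta>\<^sub>m(p) < 1\<close> for a single \<open>m\<close>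
  forces exponential decay at \<open>p\<close> and excludes an infinite component. As \<open>\<theta>\<^sub>m\<close> is a polynomial
  in \<open>p\<close>, this condition is open in \<open>p\<close>, so it fails at \<open>p\<^sub>c\<close>: for every \<open>m\<close>,
  \<open>\<theta>\<^sub>m(p\<^sub>c) \<ge> 1 / \<bar>\<partial>B\<^sub>m\<bar> \<ge> c m\<^bsup>1-d\<^esup>\<close>. Finally, an arm of length \<open>m\<close> from the origin crosses
  the annulus of outer radius \<open>m\<close>.\<close>

subsection \<open>Events depending on finitely many edges\<close>

text \<open>The probability that the set of successes among independent trials indexed by \<open>E\<close>,
  each of success probability \<open>p\<close>, satisfies \<open>Q\<close>.\<close>

definition weight :: "real \<Rightarrow> 'a set \<Rightarrow> ('a set \<Rightarrow> bool) \<Rightarrow> real" where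
  "weight p E Q = (\<Sum>S | S \<subseteq> E \<and> Q S. p ^ card S * (1 - p) ^ card (E - S))"

text \<open>Prescribing which edges of the finite set \<open>E\<close> have value 0 is a product
  cylinder, so its probability is a product of marginals.\<close>

lemma cylinder_sets_measure:
  fixes E :: "(real ^ 'd) set set"
  assumes p: "p \<in> {0..1}" and E: "finite E" "E \<subseteq> edges" and S: "S \<subseteq> E"
  shows "{\<sigma> \<in> space (percolation p). zero_edges \<sigma> \<inter> E = S} \<in> sets (percolation p)"
    and "measure (percolation p) {\<sigma> \<in> space (percolation p). zero_edges \<sigma> \<inter> E = S}
           = p ^ card S * (1 - p) ^ card (E - S)"
proof -
  define M where "M = (\<lambda>_ :: (real ^ 'd) set.
    measure_pmf (map_pmf (\<lambda>b. if b then 0 else 1 :: nat) (bernoulli_pmf p)))"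
  \<comment> \<open>Outside \<open>S\<close> the factor is \<open>- {0}\<close>, not
    \<open>{1}\<close>: points of the space may take any natural value, and with the complement the
    event equals the cylinder exactly, not just almost surely.\<close>
  define X where "X = (\<lambda>e. if e \<in> S then {0 :: nat} else - {0})"
  have perc_eq: "percolation p = PiM edges M"
    by (simp add: percolation_def M_def)
  interpret product_prob_space M edges
    by (rule product_prob_spaceI) (simp add: M_def measure_pmf.prob_space_axioms)
  have eq: "{\<sigma> \<in> space (percolation p). zero_edges \<sigma> \<inter> E = S}
      = prod_emb edges M E (Pi\<^sub>E E X)"
    using E S unfolding space_percolation prod_emb_def space_PiM zero_edges_def X_def
    by (auto simp: M_def PiE_iff extensional_def split: if_splits) fastforce
  have X: "X e \<in> sets (M e)" for e
    by (simp add: M_def)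
  show "{\<sigma> \<in> space (percolation p). zero_edges \<sigma> \<inter> E = S} \<in> sets (percolation p)"
    unfolding eq unfolding perc_eq using E X by (intro sets_PiM_I) auto
  have 0: "measure (M e) {0} = p" for e
  proof -
    have "(\<lambda>b. if b then 0 else 1 :: nat) -` {0} = {True}"
      by (auto split: if_splits)
    then show ?thesis
      using p unfolding M_def measure_map_pmf by (simp add: measure_pmf_single)
  qed
  have 1: "measure (M e) (- {0}) = 1 - p" for e
    using prob_space.prob_compl[OF prob_space, of "{0}" e] 0[of e] by (simp add: M_def Compl_eq_Diff_UNIV)
  have "measure (percolation p) {\<sigma> \<in> space (percolation p). zero_edges \<sigma> \<inter> E = S}
      = (\<Prod>e\<in>E. measure (M e) (X e))"
    unfolding eq unfolding perc_eq using E X by (intro measure_PiM_emb) auto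
  also have "\<dots> = (\<Prod>e\<in>E. if e \<in> S then p else 1 - p)"
    by (intro prod.cong) (auto simp: X_def 0 1)
  also have "\<dots> = p ^ card S * (1 - p) ^ card (E - S)"
    using E S by (simp add: prod.If_cases Int_absorb1 Diff_eq)
  finally show "measure (percolation p) {\<sigma> \<in> space (percolation p). zero_edges \<sigma> \<inter> E = S}
           = p ^ card S * (1 - p) ^ card (E - S)" .
qed

lemma prob_space_percolation: "prob_space (percolation p)"
  unfolding percolation_def by (intro prob_space_PiM measure_pmf.prob_space_axioms)

text \<open>A local event is a finite disjoint union of cylinders. This turns its probability into a
  finite sum, on which independence, translation and continuity in \<open>p\<close> are handled
  algebraically.\<close>

lemma local_event_sets_measure:
  fixes E :: "(real ^ 'd) set set"
  assumes p: "p \<in> {0..1}" and E: "finite E" "E \<subseteq> edges"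
  shows "{\<sigma> \<in> space (percolation p). Q (zero_edges \<sigma> \<inter> E)} \<in> sets (percolation p)"
    and "measure (percolation p) {\<sigma> \<in> space (percolation p). Q (zero_edges \<sigma> \<inter> E)} = weight p E Q"
proof -
  interpret prob_space "percolation p" by (rule prob_space_percolation)
  let ?C = "\<lambda>S. {\<sigma> \<in> space (percolation p). zero_edges \<sigma> \<inter> E = S}"
  have eq: "{\<sigma> \<in> space (percolation p). Q (zero_edges \<sigma> \<inter> E)} = (\<Union>S\<in>{S. S \<subseteq> E \<and> Q S}. ?C S)"
    by auto
  have fin: "finite {S. S \<subseteq> E \<and> Q S}"
    using E by simp
  note C = cylinder_sets_measure[OF p E]
  show "{\<sigma> \<in> space (percolation p). Q (zero_edges \<sigma> \<inter> E)} \<in> sets (percolation p)"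
    unfolding eq using fin C(1) by (intro sets.finite_UN) auto
  show "measure (percolation p) {\<sigma> \<in> space (percolation p). Q (zero_edges \<sigma> \<inter> E)} = weight p E Q"
    unfolding eq weight_def using fin C
    by (subst finite_measure_finite_Union) (auto simp: disjoint_family_on_def)
qed

text \<open>Subsets of a disjoint union are pairs of subsets, and their weights multiply. This is
  the form in which independence is used.\<close>

lemma weight_indep:
  assumes "finite E" "finite F" "E \<inter> F = {}"
  shows "weight p (E \<union> F) (\<lambda>S. Q (S \<inter> E) \<and> R (S \<inter> F)) = weight p E Q * weight p F R"
proof -
  let ?A = "{S. S \<subseteq> E \<and> Q S}" and ?B = "{S. S \<subseteq> F \<and> R S}"
  have "weight p E Q * weight p F R = (\<Sum>(S, T)\<in>?A \<times> ?B.
      (p ^ card S * (1 - p) ^ card (E - S)) * (p ^ card T * (1 - p) ^ card (F - T)))"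
    by (simp add: weight_def sum_product sum.cartesian_product)
  also have "\<dots> = weight p (E \<union> F) (\<lambda>S. Q (S \<inter> E) \<and> R (S \<inter> F))"
    unfolding weight_def
  proof (rule sum.reindex_bij_witness[where i = "\<lambda>S. (S \<inter> E, S \<inter> F)" and j = "\<lambda>(S, T). S \<union> T"];
      clarsimp)
    fix S T assume *: "S \<subseteq> E" "T \<subseteq> F" "Q S" "R T"
    with assms have "(S \<union> T) \<inter> E = S" "(S \<union> T) \<inter> F = T" by auto
    then show "(S \<union> T) \<inter> E = S \<and> (S \<union> T) \<inter> F = T" by simp
  next
    fix S T assume *: "S \<subseteq> E" "T \<subseteq> F" "Q S" "R T"
    with assms have "(S \<union> T) \<inter> E = S" "(S \<union> T) \<inter> F = T" by auto
    with * show "S \<subseteq> E \<union> F \<and> T \<subseteq> E \<union> F \<and> Q ((S \<union> T) \<inter> E) \<and> R ((S \<union> T) \<inter> F)" by auto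
  next
    fix S T assume *: "S \<subseteq> E" "T \<subseteq> F" "Q S" "R T"
    have "finite S" "finite T" using * assms finite_subset by blast+
    then have 1: "card (S \<union> T) = card S + card T"
      using * assms by (intro card_Un_disjoint) auto
    have "E \<union> F - (S \<union> T) = (E - S) \<union> (F - T)" using * assms by auto
    then have 2: "card (E \<union> F - (S \<union> T)) = card (E - S) + card (F - T)"
      using assms by (simp, intro card_Un_disjoint) auto
    show "p ^ card (S \<union> T) * (1 - p) ^ card (E \<union> F - (S \<union> T)) =
        p ^ card S * (1 - p) ^ card (E - S) * (p ^ card T * (1 - p) ^ card (F - T))"
      by (simp add: 1 2 power_add)
  qed auto
  finally show ?thesis by simp
qed

lemma continuous_weight: "isCont (\<lambda>p. weight p E Q) p"
  unfolding weight_def by (intro continuous_intros)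

subsection \<open>Boxes and arms\<close>

text \<open>The edge set is a free parameter, so that paths can be confined to the edges inside or
  outside a box.\<close>

definition open_step :: "(real ^ 'd::finite) set set \<Rightarrow> real ^ 'd \<Rightarrow> real ^ 'd \<Rightarrow> bool" where
  "open_step S x y \<longleftrightarrow>
     x \<in> int_lattice \<and> y \<in> int_lattice \<and> dist x y = 1 \<and> closed_segment x y \<in> S"

definition box_at :: "real ^ 'd::finite \<Rightarrow> nat \<Rightarrow> (real ^ 'd) set" where
  "box_at x n = {y. \<forall>i. \<bar>y $ i - x $ i\<bar> \<le> real n}"

text \<open>Only edges lying wholly in the closed box count; an edge with an endpoint outside is
  therefore disjoint from the box data.\<close>

definition box_edges :: "real ^ 'd::finite \<Rightarrow> nat \<Rightarrow> (real ^ 'd) set set" where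
  "box_edges x n = {e \<in> edges. e \<subseteq> box_at x n}"

definition arm :: "(real ^ 'd::finite) set set \<Rightarrow> real ^ 'd \<Rightarrow> nat \<Rightarrow> bool" where
  "arm S x n \<longleftrightarrow> (\<exists>y. (open_step S)\<^sup>*\<^sup>* x y \<and> (\<exists>i. real n \<le> \<bar>y $ i - x $ i\<bar>))"

definition box_boundary :: "nat \<Rightarrow> (real ^ 'd::finite) set" where
  "box_boundary n = {z \<in> int_lattice \<inter> box_at 0 n. \<exists>i. \<bar>z $ i\<bar> = real n}"

section \<open>Finiteness and countability of vertices and edges\<close>

lemma box_at_eq_cbox: "box_at x n = cbox (\<chi> i. x $ i - real n) (\<chi> i. x $ i + real n)"
  by (auto simp: box_at_def mem_box_cart abs_le_iff algebra_simps)

lemma finite_lattice_box: "finite (int_lattice \<inter> box_at x n :: (real ^ 'd::finite) set)"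
proof -
  let ?A = "\<lambda>i. {k \<in> \<int>. x $ i - real n \<le> k \<and> k \<le> x $ i + real n}"
  have "int_lattice \<inter> box_at x n \<subseteq> vec_lambda ` (Pi\<^sub>E UNIV ?A)"
  proof
    fix z assume "z \<in> int_lattice \<inter> box_at x n"
    then have "($) z \<in> Pi\<^sub>E UNIV ?A"
      by (auto simp: int_lattice_def box_at_def PiE_iff abs_le_iff algebra_simps)
    then show "z \<in> vec_lambda ` (Pi\<^sub>E UNIV ?A)"
      by (rule rev_image_eqI) (simp add: vec_eq_iff)
  qed
  moreover have "finite (Pi\<^sub>E UNIV ?A)"
    using finite_int_segment by (intro finite_PiE) auto
  ultimately show ?thesis
    by (blast intro: finite_subset)
qed

lemma finite_edges_meeting: "finite {e \<in> edges. e \<inter> box_at x n \<noteq> {}}"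
proof -
  \<comment> \<open>Edges have length 1, so the endpoints of an edge meeting the box lie in the box
    enlarged by 1.\<close>
  let ?V = "int_lattice \<inter> box_at x (n + 1)"
  have "{e \<in> edges. e \<inter> box_at x n \<noteq> {}} \<subseteq> (\<lambda>(a, b). closed_segment a b) ` (?V \<times> ?V)"
  proof
    fix e assume e: "e \<in> {e \<in> edges. e \<inter> box_at x n \<noteq> {}}"
    then obtain a b where ab: "e = closed_segment a b" "a \<in> int_lattice" "b \<in> int_lattice"
        "dist a b = 1"
      unfolding edges_def by blast
    with e obtain c where c: "c \<in> closed_segment a b" "c \<in> box_at x n"
      by blast
    have "v \<in> box_at x (n + 1)" if "dist c v \<le> 1" for v
    proof -
      have "\<bar>v $ i - x $ i\<bar> \<le> real n + 1" for i
      proof -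
        have "\<bar>v $ i - c $ i\<bar> \<le> 1"
          using component_le_norm_cart[of "v - c" i] that by (simp add: dist_norm norm_minus_commute)
        moreover have "\<bar>c $ i - x $ i\<bar> \<le> real n"
          using c by (simp add: box_at_def)
        ultimately show ?thesis by linarith
      qed
      then show ?thesis
        by (simp add: box_at_def add.commute)
    qed
    moreover have "dist c a \<le> 1" "dist c b \<le> 1"
      using segment_bound[OF c(1)] ab(4) by (auto simp: dist_norm norm_minus_commute)
    ultimately have "(a, b) \<in> ?V \<times> ?V"
      using ab by blast
    then show "e \<in> (\<lambda>(a, b). closed_segment a b) ` (?V \<times> ?V)"
      by (rule rev_image_eqI) (simp add: ab(1))
  qed
  then show ?thesis
    by (rule finite_subset) (intro finite_imageI finite_cartesian_product finite_lattice_box)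
qed

lemma box_edges_subset: "box_edges x n \<subseteq> edges"
  by (auto simp: box_edges_def)

lemma finite_box_edges: "finite (box_edges x n)"
proof (rule finite_subset[OF _ finite_edges_meeting[of x n]])
  show "box_edges x n \<subseteq> {e \<in> edges. e \<inter> box_at x n \<noteq> {}}"
  proof
    fix e assume e: "e \<in> box_edges x n"
    then have "e \<noteq> {}"
      unfolding box_edges_def edges_def by force
    with e show "e \<in> {e \<in> edges. e \<inter> box_at x n \<noteq> {}}"
      unfolding box_edges_def by blast
  qed
qed

lemma countable_int_lattice: "countable (int_lattice :: (real ^ 'd::finite) set)"
proof -
  have "x \<in> (\<Union>n. int_lattice \<inter> box_at 0 n)" if "x \<in> int_lattice" for x :: "real ^ 'd"
  proof -
    obtain n where "norm x \<le> real n"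
      using real_arch_simple by blast
    then have "x \<in> box_at 0 n"
      by (auto simp: box_at_def intro: order_trans[OF component_le_norm_cart])
    with that show ?thesis by blast
  qed
  moreover have "countable (\<Union>n. int_lattice \<inter> box_at 0 n :: (real ^ 'd) set)"
    using finite_lattice_box by (intro countable_UN) (auto intro: countable_finite)
  ultimately show ?thesis
    by (meson countable_subset subsetI)
qed

lemma countable_edges: "countable (edges :: (real ^ 'd::finite) set set)"
proof (rule countable_subset)
  show "edges \<subseteq> (\<lambda>(a, b). closed_segment a b) ` (int_lattice \<times> int_lattice :: ((real ^ 'd) \<times> (real ^ 'd)) set)"
    by (auto simp: edges_def)
qed (intro countable_image countable_SIGMA countable_int_lattice)

section \<open>Localising and splitting arms\<close>

lemma open_stepD:
  assumes "open_step S x y"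
  shows "y \<in> int_lattice" "\<bar>y $ i - x $ i\<bar> \<le> 1"
  using assms component_le_norm_cart[of "y - x" i]
  by (auto simp: open_step_def dist_norm norm_minus_commute)

lemma open_path_mono: "(open_step S)\<^sup>*\<^sup>* x y \<Longrightarrow> S \<subseteq> T \<Longrightarrow> (open_step T)\<^sup>*\<^sup>* x y"
  by (erule rtranclp_mono[THEN predicate2D, rotated]) (auto simp: open_step_def)

lemma arm_mono: "arm S x n \<Longrightarrow> S \<subseteq> T \<Longrightarrow> arm T x n"
  unfolding arm_def using open_path_mono by blast

text \<open>Until it first reaches sup-distance \<open>n\<close>, the path runs inside the box. Arm
  events thus depend on finitely many edges.\<close>

lemma arm_imp_arm_in_box:
  assumes "arm S x n" and S: "S \<subseteq> edges" and x: "x \<in> int_lattice"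
  shows "arm (S \<inter> box_edges x n) x n"
proof -
  let ?T = "S \<inter> box_edges x n"
  \<comment> \<open>Invariant along the path: either only box edges have been used so far, or an arm
    inside the box has already been found.\<close>
  have step: "(open_step ?T)\<^sup>*\<^sup>* x y \<and> y \<in> int_lattice \<or> arm ?T x n"
    if "(open_step S)\<^sup>*\<^sup>* x y" for y
    using that
  proof induction
    case base
    show ?case using x by simp
  next
    case (step y z)
    show ?case
    proof (cases "arm ?T x n")
      case False
      then have y: "(open_step ?T)\<^sup>*\<^sup>* x y" "y \<in> int_lattice"
        using step.IH by auto
      have lt: "\<bar>y $ i - x $ i\<bar> < real n" for i
        using False y(1) unfolding arm_def not_ex de_Morgan_conj not_le by blast
      \<comment> \<open>Coordinate differences are integers, so strict inequality leaves a margin of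
        1, enough for the next vertex to stay in the box.\<close>
      have le: "\<bar>y $ i - x $ i\<bar> \<le> real n - 1" for i
      proof -
        have "y $ i \<in> \<int>" "x $ i \<in> \<int>"
          using y x by (auto simp: int_lattice_def)
        then obtain k where k: "y $ i - x $ i = of_int k"
          by (meson Ints_cases Ints_diff)
        have "\<bar>k\<bar> < int n"
          using lt[of i] unfolding k by linarith
        then have "\<bar>k\<bar> \<le> int n - 1" by simp
        then show ?thesis unfolding k by linarith
      qed
      have "\<bar>z $ i - x $ i\<bar> \<le> real n" for i
        using le[of i] open_stepD(2)[OF step.hyps(2), of i] by linarith
      then have "z \<in> box_at x n"
        by (simp add: box_at_def)
      moreover have "y \<in> box_at x n"
        using lt by (simp add: box_at_def less_imp_le)
      ultimately have "closed_segment y z \<subseteq> box_at x n"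
        by (simp add: box_at_eq_cbox closed_segment_subset)
      then have "open_step ?T y z"
        using step.hyps(2) S by (auto simp: open_step_def box_edges_def)
      with y(1) have "(open_step ?T)\<^sup>*\<^sup>* x z"
        by (rule rtranclp.rtrancl_into_rtrancl)
      then show ?thesis
        using open_stepD(1)[OF step.hyps(2)] by blast
    qed simp
  qed
  with \<open>arm S x n\<close> show ?thesis
    unfolding arm_def by blast
qed

text \<open>Decomposing at the last visit to the box makes the second arm use edges disjoint
  from those of the box, so that independence replaces the van den Berg--Kesten inequality.\<close>

lemma arm_last_exit:
  assumes "arm S 0 (m + n)" and S: "S \<subseteq> edges" and n: "n > 0"
  shows "\<exists>z\<in>box_boundary m. arm (S - box_edges 0 m) z n"
proof -
  let ?T = "S - box_edges 0 m"
  \<comment> \<open>The invariant follows the last visit implicitly: returning to the box resets it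
    to the first alternative, and each new exit supplies a new \<open>z\<close>.\<close>
  have step: "y \<in> int_lattice \<and> (y \<in> box_at 0 m \<or> (\<exists>z\<in>box_boundary m. (open_step ?T)\<^sup>*\<^sup>* z y))"
    if "(open_step S)\<^sup>*\<^sup>* 0 y" for y
    using that
  proof induction
    case base
    show ?case by (simp add: int_lattice_def box_at_def)
  next
    case (step y w)
    have w: "w \<in> int_lattice"
      using open_stepD(1)[OF step.hyps(2)] .
    show ?case
    proof (cases "w \<in> box_at 0 m")
      case False
      then have T: "open_step ?T y w"
        using step.hyps(2) by (auto simp: open_step_def box_edges_def)
      \<comment> \<open>A unit step leaves the box here; by integrality the coordinate that exceeds
        \<open>m\<close> after the step has absolute value exactly \<open>m\<close> before
        it.\<close>
      have "y \<in> box_boundary m" if y: "y \<in> box_at 0 m"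
      proof -
        obtain i where i: "\<bar>w $ i\<bar> > real m"
          using False by (auto simp: box_at_def not_le)
        have "y $ i \<in> \<int>" "w $ i \<in> \<int>"
          using step.IH w by (auto simp: int_lattice_def)
        then obtain k l where kl: "y $ i = of_int k" "w $ i = of_int l"
          by (metis Ints_cases)
        have "\<bar>y $ i\<bar> \<le> real m"
          using y by (simp add: box_at_def)
        with i open_stepD(2)[OF T, of i]
        have "\<bar>k\<bar> \<le> int m" "int m < \<bar>l\<bar>" "\<bar>l - k\<bar> \<le> 1"
          unfolding kl by linarith+
        then have "\<bar>k\<bar> = int m" by linarith
        then have "\<bar>y $ i\<bar> = real m" unfolding kl by linarith
        with y step.IH show ?thesis by (auto simp: box_boundary_def)
      qed
      with step.IH obtain z where "z \<in> box_boundary m" "(open_step ?T)\<^sup>*\<^sup>* z y"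
        by blast
      with T have "(open_step ?T)\<^sup>*\<^sup>* z w"
        by (meson rtranclp.rtrancl_into_rtrancl)
      with w \<open>z \<in> box_boundary m\<close> show ?thesis by blast
    qed (simp add: w)
  qed
  obtain y i where y: "(open_step S)\<^sup>*\<^sup>* 0 y" and i: "real (m + n) \<le> \<bar>y $ i\<bar>"
    using assms(1) by (auto simp: arm_def)
  have "y \<notin> box_at 0 m"
    using i n by (auto simp: box_at_def not_le intro!: exI[of _ i])
  with step[OF y] obtain z where z: "z \<in> box_boundary m" "(open_step ?T)\<^sup>*\<^sup>* z y"
    by blast
  have "\<bar>z $ i\<bar> \<le> real m"
    using z by (simp add: box_boundary_def box_at_def)
  with i have "real n \<le> \<bar>y $ i - z $ i\<bar>"
    by simp
  with z show ?thesis
    unfolding arm_def by blast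
qed

section \<open>Size of the boundary of a box\<close>

lemma finite_box_boundary: "finite (box_boundary n)"
  by (rule finite_subset[OF _ finite_lattice_box[of 0 n]]) (auto simp: box_boundary_def)

lemma box_boundary_nonempty: "box_boundary n \<noteq> ({} :: (real ^ 'd::finite) set)"
proof -
  have "(\<chi> i. real n) \<in> (box_boundary n :: (real ^ 'd) set)"
    by (auto simp: box_boundary_def int_lattice_def box_at_def)
  then show ?thesis by blast
qed

lemma card_box_boundary_le:
  "card (box_boundary n :: (real ^ 'd::finite) set) \<le> 2 * CARD('d) * (2 * n + 1) ^ (CARD('d) - 1)"
proof -
  define K where "K = (of_int ` {- int n..int n} :: real set)"
  \<comment> \<open>\<open>F (i, s)\<close> contains the lattice points of the face on which
    coordinate \<open>i\<close> equals \<open>s\<close>; the other coordinates range over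
    \<open>K\<close>.\<close>
  define F where "F = (\<lambda>(i :: 'd, s). (\<lambda>f. (\<chi> j. if j = i then s else f j) :: real ^ 'd) `
    (Pi\<^sub>E (UNIV - {i}) (\<lambda>_. K)))"
  let ?I = "(UNIV :: 'd set) \<times> {real n, - real n}"
  have K: "finite K" "card K = 2 * n + 1"
    unfolding K_def by (auto simp: card_image inj_on_def)
  have "box_boundary n \<subseteq> \<Union> (F ` ?I)"
  proof
    fix z :: "real ^ 'd" assume z: "z \<in> box_boundary n"
    then obtain i where i: "\<bar>z $ i\<bar> = real n"
      by (auto simp: box_boundary_def)
    have "z $ j \<in> K" for j
    proof -
      have "z $ j \<in> \<int>" "\<bar>z $ j\<bar> \<le> real n"
        using z by (auto simp: box_boundary_def int_lattice_def box_at_def)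
      then obtain k where k: "z $ j = of_int k" "\<bar>z $ j\<bar> \<le> real n"
        by (metis Ints_cases)
      then have "k \<in> {- int n..int n}" by auto
      with k show ?thesis unfolding K_def by blast
    qed
    then have "restrict (($) z) (UNIV - {i}) \<in> Pi\<^sub>E (UNIV - {i}) (\<lambda>_. K)"
      by simp
    then have "z \<in> F (i, z $ i)"
      unfolding F_def prod.case by (rule rev_image_eqI) (simp add: vec_eq_iff)
    moreover have "(i, z $ i) \<in> ?I"
      using i by auto
    ultimately show "z \<in> \<Union> (F ` ?I)" by blast
  qed
  moreover have fin: "finite (F (i, s))" for i s
    unfolding F_def using K by (auto intro!: finite_PiE)
  ultimately have "card (box_boundary n :: (real ^ 'd) set) \<le> card (\<Union> (F ` ?I))"
    by (intro card_mono) auto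
  also have "\<dots> \<le> (\<Sum>a\<in>?I. card (F a))"
    by (intro card_UN_le) auto
  also have "\<dots> \<le> (\<Sum>a\<in>?I. (2 * n + 1) ^ (CARD('d) - 1))"
  proof (rule sum_mono)
    fix a :: "'d \<times> real"
    obtain i s where a: "a = (i, s)" by force
    have "card (F a) \<le> card (Pi\<^sub>E (UNIV - {i}) (\<lambda>_. K))"
      unfolding F_def a using K by (auto intro!: card_image_le finite_PiE)
    then show "card (F a) \<le> (2 * n + 1) ^ (CARD('d) - 1)"
      by (simp add: card_PiE K)
  qed
  also have "\<dots> = card ?I * (2 * n + 1) ^ (CARD('d) - 1)"
    by simp
  \<comment> \<open>Only an inequality, since the two opposite faces coincide for
    \<open>n = 0\<close>.\<close>
  also have "\<dots> \<le> (2 * CARD('d)) * (2 * n + 1) ^ (CARD('d) - 1)"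
    by (intro mult_right_mono) (auto simp: card_insert_if card_cartesian_product)
  finally show ?thesis .
qed

section \<open>Translation by lattice vectors\<close>

lemma edges_translate:
  assumes "x \<in> int_lattice" "e \<in> edges"
  shows "(+) x ` e \<in> edges"
proof -
  obtain a b where "e = closed_segment a b" "a \<in> int_lattice" "b \<in> int_lattice" "dist a b = 1"
    using assms by (auto simp: edges_def)
  then have "(+) x ` e = closed_segment (x + a) (x + b)" "x + a \<in> int_lattice"
      "x + b \<in> int_lattice" "dist (x + a) (x + b) = 1"
    using assms by (auto simp: closed_segment_translation int_lattice_def)
  then show ?thesis
    unfolding edges_def by blast
qed

lemma box_edges_translate:
  assumes x: "x \<in> int_lattice"
  shows "image ((+) x) ` box_edges a n = box_edges (x + a) n"
proof -
  \<comment> \<open>Proved for all translations, so that the reverse inclusion follows by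
    translating back with \<open>- x\<close>.\<close>
  have sub: "image ((+) x) ` box_edges a n \<subseteq> box_edges (x + a) n" if "x \<in> int_lattice" for x a :: "real ^ 'd"
    using that by (auto simp: box_edges_def edges_translate) (auto simp: box_at_def)
  have "box_edges (x + a) n = image ((+) x) ` image ((+) (- x)) ` box_edges (x + a) n"
    by (simp add: image_image)
  also have "\<dots> \<subseteq> image ((+) x) ` box_edges a n"
    using sub[of "- x" "x + a"] x by (intro image_mono) (auto simp: int_lattice_def)
  finally show ?thesis
    using sub[OF x] by blast
qed

lemma arm_translate:
  assumes x: "x \<in> int_lattice" and "arm S a n"
  shows "arm (image ((+) x) ` S) (x + a) n"
proof -
  have "(open_step (image ((+) x) ` S))\<^sup>*\<^sup>* (x + a) (x + b)" if "(open_step S)\<^sup>*\<^sup>* a b" for b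
    using that
  proof induction
    case (step b c)
    then have "open_step (image ((+) x) ` S) (x + b) (x + c)"
      using x by (auto simp: open_step_def int_lattice_def closed_segment_translation)
    with step.IH show ?case by simp
  qed simp
  with \<open>arm S a n\<close> show ?thesis
    unfolding arm_def by fastforce
qed

text \<open>Translation injects the arm configurations at \<open>a\<close> into those at
  \<open>x + a\<close> and preserves their weights. Taking \<open>- x\<close> for \<open>x\<close>
  compares an arm at any vertex with one at the origin.\<close>

lemma weight_arm_translate:
  assumes p: "p \<in> {0..1}" and x: "x \<in> int_lattice"
  shows "weight p (box_edges a n) (\<lambda>S. arm S a n) \<le> weight p (box_edges (x + a) n) (\<lambda>S. arm S (x + a) n)"
proof -
  let ?t = "image ((+) x)"
  let ?A = "{S. S \<subseteq> box_edges a n \<and> arm S a n}"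
  let ?B = "{S. S \<subseteq> box_edges (x + a) n \<and> arm S (x + a) n}"
  let ?w = "\<lambda>b S. p ^ card S * (1 - p) ^ card (box_edges b n - S)"
  have t: "inj ?t" by (simp add: inj_image_eq_iff inj_def)
  have "weight p (box_edges a n) (\<lambda>S. arm S a n) = (\<Sum>S\<in>?A. ?w (x + a) (?t ` S))"
    unfolding weight_def box_edges_translate[OF x, symmetric]
    using t by (simp add: image_set_diff[symmetric] card_image inj_on_subset)
  also have "\<dots> = (\<Sum>S\<in>image ?t ` ?A. ?w (x + a) S)"
    using t by (subst sum.reindex) (auto simp: inj_on_def inj_image_eq_iff)
  also have "\<dots> \<le> (\<Sum>S\<in>?B. ?w (x + a) S)"
  proof (rule sum_mono2)
    show "finite ?B" using finite_box_edges[of "x + a" n] by simp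
    show "image ?t ` ?A \<subseteq> ?B"
    proof (rule image_subsetI)
      fix S assume "S \<in> ?A"
      then have "?t ` S \<subseteq> ?t ` box_edges a n" "arm (?t ` S) (x + a) n"
        using arm_translate[OF x] by (simp_all add: image_mono)
      then show "?t ` S \<in> ?B"
        by (simp only: box_edges_translate[OF x] mem_Collect_eq simp_thms)
    qed
  qed (use p in auto)
  finally show ?thesis by (simp add: weight_def)
qed

subsection \<open>Submultiplicativity of the one-arm probability\<close>

definition arm_prob :: "'d::finite itself \<Rightarrow> real \<Rightarrow> nat \<Rightarrow> real" where
  "arm_prob _ p n = weight p (box_edges (0 :: real ^ 'd) n) (\<lambda>S. arm S 0 n)"

abbreviation arm_event :: "real \<Rightarrow> real ^ 'd::finite \<Rightarrow> nat \<Rightarrow> ((real ^ 'd) set \<Rightarrow> nat) set" where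
  "arm_event p x n \<equiv> {\<sigma> \<in> space (percolation p). arm (zero_edges \<sigma> \<inter> box_edges x n) x n}"

lemma arm_event_sets:
  assumes "p \<in> {0..1}"
  shows "arm_event p x n \<in> sets (percolation p)"
  by (rule local_event_sets_measure(1)[OF assms finite_box_edges box_edges_subset])

lemma measure_arm_event_0:
  assumes "p \<in> {0..1}"
  shows "measure (percolation p) (arm_event p (0 :: real ^ 'd::finite) n) = arm_prob TYPE('d) p n"
  unfolding arm_prob_def
  by (rule local_event_sets_measure(2)[OF assms finite_box_edges box_edges_subset])

lemma measure_arm_event_le:
  fixes x :: "real ^ 'd::finite"
  assumes p: "p \<in> {0..1}" and x: "x \<in> int_lattice"
  shows "measure (percolation p) (arm_event p x n) \<le> arm_prob TYPE('d) p n"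
proof -
  have "measure (percolation p) (arm_event p x n) = weight p (box_edges x n) (\<lambda>S. arm S x n)"
    by (rule local_event_sets_measure(2)[OF p finite_box_edges box_edges_subset])
  also have "\<dots> \<le> arm_prob TYPE('d) p n"
    using weight_arm_translate[OF p, of "- x" x n] x by (simp add: arm_prob_def int_lattice_def)
  finally show ?thesis .
qed

lemma zero_edges_subset: "zero_edges \<sigma> \<subseteq> edges"
  by (auto simp: zero_edges_def)

lemma arm_prob_nonneg: "p \<in> {0..1} \<Longrightarrow> 0 \<le> arm_prob TYPE('d::finite) p n"
  by (subst measure_arm_event_0[symmetric]) auto

text \<open>Union bound over the boundary vertex \<open>z\<close> of the last exit; for each
  \<open>z\<close>, the arm inside the box and the arm from \<open>z\<close> outside it are
  independent.\<close>

lemma arm_prob_add_le: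
  assumes p: "p \<in> {0..1}" and n: "n > 0"
  shows "arm_prob TYPE('d::finite) p (m + n) \<le>
    real (card (box_boundary m :: (real ^ 'd) set)) * arm_prob TYPE('d) p m * arm_prob TYPE('d) p n"
proof -
  interpret prob_space "percolation p :: ((real ^ 'd) set \<Rightarrow> nat) measure"
    by (rule prob_space_percolation)
  let ?B = "box_edges (0 :: real ^ 'd) m"
  \<comment> \<open>Removing the box edges makes the two edge sets disjoint, as
    \<open>weight_indep\<close> requires; monotonicity of arms later puts these edges back.\<close>
  define D where "D = (\<lambda>z :: real ^ 'd. box_edges z n - ?B)"
  define A where "A = (\<lambda>z. {\<sigma> \<in> space (percolation p).
    arm (zero_edges \<sigma> \<inter> ?B) 0 m \<and> arm (zero_edges \<sigma> \<inter> D z) z n})"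
  have D: "finite (D z)" "D z \<subseteq> edges" for z
    using finite_box_edges[of z n] box_edges_subset[of z n] by (auto simp: D_def)
  have BD: "finite (?B \<union> D z)" "?B \<union> D z \<subseteq> edges" for z
    using finite_box_edges[of 0 m] box_edges_subset[of 0 m] D by auto
  have A_eq: "A z = {\<sigma> \<in> space (percolation p).
      (\<lambda>S. arm (S \<inter> ?B) 0 m \<and> arm (S \<inter> D z) z n) (zero_edges \<sigma> \<inter> (?B \<union> D z))}" for z
  proof -
    have "zero_edges \<sigma> \<inter> (?B \<union> D z) \<inter> ?B = zero_edges \<sigma> \<inter> ?B"
      "zero_edges \<sigma> \<inter> (?B \<union> D z) \<inter> D z = zero_edges \<sigma> \<inter> D z" for \<sigma>
      by auto
    then show ?thesis by (simp add: A_def)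
  qed
  have A_sets: "A z \<in> events" for z
    unfolding A_eq by (rule local_event_sets_measure(1)[OF p BD])
  have A_prob: "prob (A z) \<le> arm_prob TYPE('d) p m * arm_prob TYPE('d) p n"
    if z: "z \<in> box_boundary m" for z
  proof -
    have "prob (A z) = weight p (?B \<union> D z) (\<lambda>S. arm (S \<inter> ?B) 0 m \<and> arm (S \<inter> D z) z n)"
      unfolding A_eq by (rule local_event_sets_measure(2)[OF p BD])
    also have "\<dots> = arm_prob TYPE('d) p m * weight p (D z) (\<lambda>S. arm S z n)"
      unfolding arm_prob_def using finite_box_edges D
      by (intro weight_indep) (auto simp: D_def)
    also have "weight p (D z) (\<lambda>S. arm S z n)
        = prob {\<sigma> \<in> space (percolation p). arm (zero_edges \<sigma> \<inter> D z) z n}"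
      by (rule local_event_sets_measure(2)[OF p D, symmetric])
    also have "\<dots> \<le> prob (arm_event p z n)"
    proof (rule finite_measure_mono)
      show "{\<sigma> \<in> space (percolation p). arm (zero_edges \<sigma> \<inter> D z) z n} \<subseteq> arm_event p z n"
      proof (intro subsetI CollectI conjI)
        fix \<sigma> assume \<sigma>: "\<sigma> \<in> {\<sigma> \<in> space (percolation p). arm (zero_edges \<sigma> \<inter> D z) z n}"
        then show "\<sigma> \<in> space (percolation p)" by simp
        have "arm (zero_edges \<sigma> \<inter> D z) z n"
          using \<sigma> by simp
        then show "arm (zero_edges \<sigma> \<inter> box_edges z n) z n"
          by (rule arm_mono) (auto simp: D_def)
      qed
    qed (rule arm_event_sets[OF p])
    also have "\<dots> \<le> arm_prob TYPE('d) p n"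
      using z by (intro measure_arm_event_le p) (auto simp: box_boundary_def)
    finally show ?thesis
      using arm_prob_nonneg[OF p, where 'd='d] by (simp add: mult_left_mono)
  qed
  have "arm_event p 0 (m + n) \<subseteq> (\<Union>z\<in>box_boundary m. A z)"
  proof
    fix \<sigma> assume \<sigma>: "\<sigma> \<in> arm_event p (0 :: real ^ 'd) (m + n)"
    let ?S = "zero_edges \<sigma> \<inter> box_edges 0 (m + n)"
    have S: "?S \<subseteq> edges" and arm: "arm ?S 0 (m + n)"
      using \<sigma> zero_edges_subset[of \<sigma>] by auto
    obtain y i where y: "(open_step ?S)\<^sup>*\<^sup>* 0 y" "real (m + n) \<le> \<bar>y $ i - 0 $ i\<bar>"
      using arm unfolding arm_def by blast
    have "real m \<le> \<bar>y $ i - 0 $ i\<bar>"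
      using y(2) by simp
    with y(1) have "arm ?S 0 m"
      unfolding arm_def by blast
    then have "arm (?S \<inter> ?B) 0 m"
      by (rule arm_imp_arm_in_box[OF _ S]) (simp add: int_lattice_def)
    then have 1: "arm (zero_edges \<sigma> \<inter> ?B) 0 m"
      by (rule arm_mono) auto
    obtain z where z: "z \<in> box_boundary m" "arm (?S - ?B) z n"
      using arm_last_exit[OF arm S n] by blast
    have "arm ((?S - ?B) \<inter> box_edges z n) z n"
      using z S by (intro arm_imp_arm_in_box) (auto simp: box_boundary_def)
    then have "arm (zero_edges \<sigma> \<inter> D z) z n"
      by (rule arm_mono) (auto simp: D_def)
    with 1 z \<sigma> show "\<sigma> \<in> (\<Union>z\<in>box_boundary m. A z)"
      by (auto simp: A_def)
  qed
  then have "prob (arm_event p 0 (m + n)) \<le> prob (\<Union>z\<in>box_boundary m. A z)"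
    using A_sets finite_box_boundary by (intro finite_measure_mono sets.finite_UN) auto
  also have "\<dots> \<le> (\<Sum>z\<in>box_boundary m. prob (A z))"
    using A_sets finite_box_boundary by (intro finite_measure_subadditive_finite) auto
  also have "\<dots> \<le> (\<Sum>z\<in>(box_boundary m :: (real ^ 'd) set). arm_prob TYPE('d) p m * arm_prob TYPE('d) p n)"
    by (intro sum_mono A_prob)
  finally show ?thesis
    using p by (simp add: measure_arm_event_0 mult.assoc)
qed

text \<open>Iterates \<open>arm_prob_add_le\<close>. The base case is the trivial bound 1 at scale
  \<open>m\<close>, hence the exponent \<open>k\<close> at scale \<open>Suc k * m\<close>.\<close>

lemma arm_prob_le_power:
  assumes p: "p \<in> {0..1}" and m: "m > 0"
  shows "arm_prob TYPE('d::finite) p (Suc k * m) \<le>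
    (real (card (box_boundary m :: (real ^ 'd) set)) * arm_prob TYPE('d) p m) ^ k"
proof (induction k)
  case 0
  interpret prob_space "percolation p :: ((real ^ 'd) set \<Rightarrow> nat) measure"
    by (rule prob_space_percolation)
  show ?case
    using prob_le_1[of "arm_event p 0 m"] by (simp add: measure_arm_event_0[OF p])
next
  case (Suc k)
  have "arm_prob TYPE('d) p (m + Suc k * m) \<le>
      real (card (box_boundary m :: (real ^ 'd) set)) * arm_prob TYPE('d) p m * arm_prob TYPE('d) p (Suc k * m)"
    using m by (intro arm_prob_add_le[OF p]) simp
  also have "\<dots> \<le> real (card (box_boundary m :: (real ^ 'd) set)) * arm_prob TYPE('d) p m *
      (real (card (box_boundary m :: (real ^ 'd) set)) * arm_prob TYPE('d) p m) ^ k"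
    by (intro mult_left_mono Suc.IH mult_nonneg_nonneg arm_prob_nonneg[OF p]) simp
  finally show ?case by simp
qed

section \<open>From decay of arms to absence of infinite components\<close>

lemma zero_adj_eq_open_step: "zero_adj \<sigma> = open_step (zero_edges \<sigma>)"
  by (intro ext) (simp add: zero_adj_def open_step_def)

text \<open>A box contains only finitely many vertices, so an infinite component must leave
  it.\<close>

lemma infinite_component_imp_arm:
  assumes "infinite (zero_component \<sigma> x)" and x: "x \<in> int_lattice"
  shows "arm (zero_edges \<sigma> \<inter> box_edges x n) x n"
proof (rule arm_imp_arm_in_box[OF _ zero_edges_subset x], rule ccontr)
  assume not: "\<not> arm (zero_edges \<sigma>) x n"
  have "zero_component \<sigma> x \<subseteq> int_lattice \<inter> box_at x n"
  proof
    fix y assume "y \<in> zero_component \<sigma> x"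
    then have y: "(open_step (zero_edges \<sigma>))\<^sup>*\<^sup>* x y"
      by (simp add: zero_component_def zero_adj_eq_open_step)
    then have "y \<in> int_lattice"
      by cases (use x in \<open>auto simp: open_step_def\<close>)
    moreover have "\<bar>y $ i - x $ i\<bar> \<le> real n" for i
      using not y unfolding arm_def by (meson linear)
    ultimately show "y \<in> int_lattice \<inter> box_at x n"
      by (simp add: box_at_def)
  qed
  with assms show False
    using finite_lattice_box finite_subset by blast
qed

lemma AE_no_infinite_component:
  fixes p :: real
  assumes p: "p \<in> {0..1}" and m: "m > 0"
    and less: "real (card (box_boundary m :: (real ^ 'd::finite) set)) * arm_prob TYPE('d) p m < 1"
  shows "AE \<sigma> in (percolation p :: ((real ^ 'd) set \<Rightarrow> nat) measure).
           \<not> (\<exists>x\<in>int_lattice. infinite (zero_component \<sigma> x))"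
proof -
  interpret prob_space "percolation p :: ((real ^ 'd) set \<Rightarrow> nat) measure"
    by (rule prob_space_percolation)
  let ?r = "real (card (box_boundary m :: (real ^ 'd) set)) * arm_prob TYPE('d) p m"
  have "AE \<sigma> in percolation p. finite (zero_component \<sigma> x)"
    if x: "x \<in> int_lattice" for x :: "real ^ 'd"
  proof -
    \<comment> \<open>A measurable event containing every configuration with an infinite component
      at \<open>x\<close>; showing that \<open>N\<close> is null avoids proving the latter set
      measurable.\<close>
    define N where "N = (\<Inter>k. arm_event p x (Suc k * m))"
    have N: "N \<in> events"
      unfolding N_def using arm_event_sets[OF p] by (intro sets.countable_INT) auto
    have "prob N \<le> ?r ^ k" for k
    proof -
      have "prob N \<le> prob (arm_event p x (Suc k * m))"
        unfolding N_def by (intro finite_measure_mono arm_event_sets[OF p]) blast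
      also have "\<dots> \<le> ?r ^ k"
        using measure_arm_event_le[OF p x] arm_prob_le_power[OF p m] by (rule order_trans)
      finally show ?thesis .
    qed
    moreover have "(\<lambda>k. ?r ^ k) \<longlonglongrightarrow> 0"
      using less arm_prob_nonneg[OF p, where 'd='d] by (intro LIMSEQ_realpow_zero) auto
    ultimately have "prob N \<le> 0"
      by (intro LIMSEQ_le_const) auto
    then have "N \<in> null_sets (percolation p)"
      using N by (auto simp: null_sets_def emeasure_eq_measure measure_le_0_iff)
    then show ?thesis
      by (rule AE_I') (auto simp: N_def intro: infinite_component_imp_arm[OF _ x])
  qed
  then have "AE \<sigma> in percolation p. \<forall>x\<in>(int_lattice :: (real ^ 'd) set). finite (zero_component \<sigma> x)"
    using countable_int_lattice by (subst AE_ball_countable) auto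
  then show ?thesis by simp
qed

subsection \<open>The critical point\<close>

lemma arm_edges: "arm edges (0 :: real ^ 'd::finite) n"
proof -
  obtain i :: 'd where True by simp
  have "(open_step edges)\<^sup>*\<^sup>* 0 (axis i (real n) :: real ^ 'd)"
  proof (induction n)
    case 0
    then show ?case by (simp add: axis_def zero_vec_def)
  next
    case (Suc n)
    have "axis i (real n) \<in> (int_lattice :: (real ^ 'd) set)" for n
      by (auto simp: int_lattice_def axis_def)
    moreover have "axis i (real n) - axis i (real (Suc n)) = - (axis i 1 :: real ^ 'd)"
      by (simp add: vec_eq_iff axis_def)
    then have "dist (axis i (real n)) (axis i (real (Suc n)) :: real ^ 'd) = 1"
      by (simp add: dist_norm)
    ultimately have "open_step edges (axis i (real n)) (axis i (real (Suc n)) :: real ^ 'd)"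
      unfolding open_step_def edges_def by blast
    with Suc show ?case
      by (rule rtranclp.rtrancl_into_rtrancl)
  qed
  then show ?thesis
    unfolding arm_def by (auto simp: axis_def intro!: exI[of _ i])
qed

text \<open>At \<open>p = 1\<close> only the full configuration has nonzero weight, and it contains
  a straight arm. This is what excludes \<open>p_c = 1\<close> if the criterion holds at
  \<open>p_c\<close>.\<close>

lemma arm_prob_1: "arm_prob TYPE('d::finite) 1 n = 1"
proof -
  let ?B = "box_edges (0 :: real ^ 'd) n"
  have "arm (edges \<inter> ?B) 0 n"
    by (rule arm_imp_arm_in_box[OF arm_edges]) (auto simp: int_lattice_def)
  then have B: "arm ?B 0 n"
    using box_edges_subset[of "0 :: real ^ 'd" n] by (simp add: Int_absorb1)
  have "arm_prob TYPE('d) 1 n = (\<Sum>S | S \<subseteq> ?B \<and> arm S 0 n. if S = ?B then 1 else 0)"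
    unfolding arm_prob_def weight_def using finite_box_edges[of 0 n]
    by (intro sum.cong) (auto simp: card_gt_0_iff)
  also have "\<dots> = 1"
    using B finite_box_edges[of 0 n] by (subst sum.delta) auto
  finally show ?thesis .
qed

text \<open>At \<open>p = 0\<close> only the empty configuration has nonzero weight. The criterion
  thus holds at 0, so the set defining \<open>p_c\<close> is nonempty and its supremum
  meaningful.\<close>

lemma arm_prob_0_1: "arm_prob TYPE('d::finite) 0 (Suc 0) = 0"
proof -
  have "S \<noteq> {}" if "arm S (0 :: real ^ 'd) (Suc 0)" for S
  proof
    assume "S = {}"
    from that obtain y i where "(open_step S)\<^sup>*\<^sup>* 0 y" "1 \<le> \<bar>y $ i\<bar>"
      by (auto simp: arm_def)
    then show False
      by cases (auto simp: open_step_def \<open>S = {}\<close>)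
  qed
  then show ?thesis
    unfolding arm_prob_def weight_def using finite_box_edges[of "0 :: real ^ 'd" "Suc 0"] finite_subset
    by (intro sum.neutral) (auto simp: card_gt_0_iff)
qed

lemma p_c_bounds: "p_c TYPE('d::finite) \<in> {0..1}"
  and p_c_upper: "\<lbrakk>p \<in> {0..1}; m > 0;
    real (card (box_boundary m :: (real ^ 'd) set)) * arm_prob TYPE('d) p m < 1\<rbrakk> \<Longrightarrow> p \<le> p_c TYPE('d)"
proof -
  let ?P = "{p \<in> {0..1}. AE \<sigma> in (percolation p :: ((real ^ 'd) set \<Rightarrow> nat) measure).
                 \<not> (\<exists>x \<in> int_lattice. infinite (zero_component \<sigma> x))}"
  have bdd: "bdd_above ?P" by (rule bdd_aboveI[of _ 1]) auto
  have 0: "0 \<in> ?P"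
    using AE_no_infinite_component[of 0 1, where 'd='d] arm_prob_0_1[where 'd='d] by simp
  have "0 \<le> Sup ?P" by (rule cSup_upper[OF 0 bdd])
  moreover have "Sup ?P \<le> 1"
  proof (rule cSup_least)
    show "?P \<noteq> {}" using 0 by blast
  qed simp
  ultimately show "p_c TYPE('d) \<in> {0..1}" by (simp add: p_c_def)
  show "p \<le> p_c TYPE('d)" if "p \<in> {0..1}" "m > 0"
    "real (card (box_boundary m :: (real ^ 'd) set)) * arm_prob TYPE('d) p m < 1"
    unfolding p_c_def using AE_no_infinite_component[OF that] that(1) bdd
    by (intro cSup_upper) auto
qed

text \<open>Otherwise continuity would carry the strict inequality to some \<open>p\<close> slightly
  above \<open>p_c\<close>, contradicting \<open>p_c_upper\<close>.\<close>

lemma critical_arm_prob_ge: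
  assumes m: "m > 0"
  shows "1 \<le> real (card (box_boundary m :: (real ^ 'd::finite) set)) * arm_prob TYPE('d) (p_c TYPE('d)) m"
proof (rule ccontr)
  let ?f = "\<lambda>p. real (card (box_boundary m :: (real ^ 'd) set)) * arm_prob TYPE('d) p m"
  assume "\<not> 1 \<le> ?f (p_c TYPE('d))"
  then have less: "?f (p_c TYPE('d)) < 1" by simp
  have "card (box_boundary m :: (real ^ 'd) set) > 0"
    unfolding card_gt_0_iff using box_boundary_nonempty finite_box_boundary by blast
  \<comment> \<open>The strict inequality fails at 1, so \<open>p_c < 1\<close> and there is room to
    the right of \<open>p_c\<close>.\<close>
  then have "1 \<le> ?f 1"
    by (simp add: arm_prob_1)
  with less have "p_c TYPE('d) \<noteq> 1" by auto
  then have p1: "p_c TYPE('d) < 1"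
    using p_c_bounds[where 'd='d] by auto
  have "isCont ?f (p_c TYPE('d))"
    unfolding arm_prob_def by (intro continuous_intros continuous_weight)
  then have "(?f \<longlongrightarrow> ?f (p_c TYPE('d))) (at_right (p_c TYPE('d)))"
    by (simp add: isCont_def filterlim_at_split)
  then have "\<forall>\<^sub>F p in at_right (p_c TYPE('d)). ?f p < 1"
    using less by (rule order_tendstoD)
  moreover have "\<forall>\<^sub>F p in at_right (p_c TYPE('d)). p < 1 \<and> p > p_c TYPE('d)"
    using p1 eventually_at_right_real[OF p1] by (auto elim: eventually_mono)
  ultimately have "\<forall>\<^sub>F p in at_right (p_c TYPE('d)). False"
  proof eventually_elim
    case (elim p)
    moreover have "p \<in> {0..1}"
      using elim p_c_bounds[where 'd='d] by auto
    ultimately show False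
      using p_c_upper[OF _ m, of p, where 'd='d] by simp
  qed
  then show False
    by simp
qed

subsection \<open>Crossings of annuli\<close>

text \<open>A path is compact, hence covered by finitely many edges, and there are only countably many
  finite sets of edges.\<close>

lemma Cross0_sets:
  fixes p :: real
  assumes p: "p \<in> {0..1}"
  shows "(Cross0 R :: ((real ^ 'd::finite) set \<Rightarrow> nat) set) \<in> sets (percolation p)"
proof -
  define Q where "Q = (\<lambda>A :: (real ^ 'd) set set. \<exists>\<gamma>. path \<gamma> \<and> path_image \<gamma> \<subseteq> \<Union> A \<and>
                 pathstart \<gamma> \<in> sphere 0 1 \<and> pathfinish \<gamma> \<in> sphere 0 R)"
  let ?F = "{A. finite A \<and> A \<subseteq> (edges :: (real ^ 'd) set set) \<and> Q A}"
  have Q_mono: "Q A \<Longrightarrow> A \<subseteq> B \<Longrightarrow> Q B" for A B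
    unfolding Q_def by (meson Union_mono order_trans)
  \<comment> \<open>\<open>zero_edges \<sigma> \<inter> A = A\<close> expresses that all edges of
    \<open>A\<close> have value 0, in the form of a cylinder with \<open>S = E = A\<close>.\<close>
  have eq: "Cross0 R = (\<Union>A\<in>?F. {\<sigma> \<in> space (percolation p). zero_edges \<sigma> \<inter> A = A})" (is "_ = ?U")
  proof (intro equalityI subsetI)
    fix \<sigma> :: "(real ^ 'd) set \<Rightarrow> nat" assume "\<sigma> \<in> Cross0 R"
    then obtain \<gamma> where \<sigma>: "\<sigma> \<in> space (percolation p)" and \<gamma>: "path \<gamma>"
        "path_image \<gamma> \<subseteq> \<Union> (zero_edges \<sigma>)" "pathstart \<gamma> \<in> sphere 0 1" "pathfinish \<gamma> \<in> sphere 0 R"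
      by (auto simp: Cross0_def space_percolation)
    obtain b where b: "\<forall>x\<in>path_image \<gamma>. norm x \<le> b"
      using bounded_path_image[OF \<gamma>(1)] by (auto simp: bounded_iff)
    obtain n where n: "b \<le> real n"
      using real_arch_simple by blast
    have box: "path_image \<gamma> \<subseteq> box_at 0 n"
    proof
      fix x assume "x \<in> path_image \<gamma>"
      then have "norm x \<le> real n"
        using b n by fastforce
      then show "x \<in> box_at 0 n"
        by (auto simp: box_at_def intro: order_trans[OF component_le_norm_cart])
    qed
    let ?A = "zero_edges \<sigma> \<inter> {e \<in> edges. e \<inter> box_at 0 n \<noteq> {}}"
    have "path_image \<gamma> \<subseteq> \<Union> ?A"
      using \<gamma>(2) box zero_edges_subset[of \<sigma>] by blast
    then have "?A \<in> ?F"
      using \<gamma> finite_edges_meeting[of 0 n] by (auto simp: Q_def)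
    moreover have "\<sigma> \<in> {\<sigma> \<in> space (percolation p). zero_edges \<sigma> \<inter> ?A = ?A}"
      using \<sigma> by blast
    ultimately show "\<sigma> \<in> ?U"
      by (rule UN_I)
  next
    fix \<sigma> assume "\<sigma> \<in> ?U"
    then obtain A where "\<sigma> \<in> space (percolation p)" "Q A" "A \<subseteq> zero_edges \<sigma>"
      by blast
    then have "\<sigma> \<in> space (percolation p)" "Q (zero_edges \<sigma>)"
      using Q_mono by auto
    then show "\<sigma> \<in> Cross0 R"
      by (simp add: Cross0_def Q_def space_percolation)
  qed
  have "countable ?F"
    by (rule countable_subset[OF _ countable_Collect_finite_subset[OF countable_edges]]) auto
  moreover have "{\<sigma> \<in> space (percolation p). zero_edges \<sigma> \<inter> A = A} \<in> sets (percolation p)"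
    if "A \<in> ?F" for A
    using that by (intro cylinder_sets_measure(1)[OF p]) auto
  ultimately show ?thesis
    unfolding eq by (rule sets.countable_UN'')
qed

text \<open>The sup norm is at most the Euclidean norm, so the arm reaches Euclidean norm at least
  \<open>m\<close>, and the intermediate value theorem finds points on both spheres.\<close>

lemma arm_event_subset_Cross0:
  fixes p :: real
  assumes m: "m > 0"
  shows "arm_event p 0 m \<subseteq> (Cross0 (real m) :: ((real ^ 'd::finite) set \<Rightarrow> nat) set)"
proof
  fix \<sigma> assume \<sigma>: "\<sigma> \<in> arm_event p (0 :: real ^ 'd) m"
  have "arm (zero_edges \<sigma> \<inter> box_edges 0 m) 0 m"
    using \<sigma> by simp
  then have "arm (zero_edges \<sigma>) 0 m"
    by (rule arm_mono) simp
  then obtain y i where y: "(open_step (zero_edges \<sigma>))\<^sup>*\<^sup>* 0 y" "real m \<le> \<bar>y $ i\<bar>"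
    by (auto simp: arm_def)
  let ?U = "\<Union> (zero_edges \<sigma>)"
  \<comment> \<open>The case \<open>y = 0\<close> is separate because \<open>path_component\<close>
    is reflexive only at points of \<open>?U\<close>, and the origin might lie on no edge of value
    0.\<close>
  have "y = 0 \<or> path_component ?U 0 y"
    using y(1)
  proof induction
    case (step y z)
    have "path_component ?U y z"
      using step.hyps(2) by (intro path_component_linepath) (auto simp: open_step_def)
    with step.IH show ?case
      using path_component_trans by blast
  qed simp
  moreover have norm: "real m \<le> norm y"
    using y(2) component_le_norm_cart[of y i] by linarith
  ultimately obtain \<gamma> where \<gamma>: "path \<gamma>" "path_image \<gamma> \<subseteq> ?U" "pathstart \<gamma> = 0" "pathfinish \<gamma> = y"
    using m unfolding path_component_def by fastforce
  have hit: "\<exists>t\<in>{0..1}. norm (\<gamma> t) = r" if "0 \<le> r" "r \<le> real m" for r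
  proof -
    have "continuous_on {0..1} (\<lambda>t. norm (\<gamma> t))"
      using \<gamma>(1) by (auto simp: path_def intro: continuous_on_norm)
    then have "\<exists>t\<ge>0. t \<le> 1 \<and> norm (\<gamma> t) = r"
      using \<gamma>(3,4) that norm by (intro IVT') (auto simp: pathstart_def pathfinish_def)
    then show ?thesis by auto
  qed
  obtain s where s: "s \<in> {0..1}" "norm (\<gamma> s) = 1"
    using hit[of 1] m by auto
  obtain t where t: "t \<in> {0..1}" "norm (\<gamma> t) = real m"
    using hit[of "real m"] by auto
  \<comment> \<open>\<open>subpath\<close> runs backwards when \<open>t < s\<close>, so the order of
    the two hitting times does not matter.\<close>
  have "path (subpath s t \<gamma>)" "path_image (subpath s t \<gamma>) \<subseteq> ?U"
    using path_subpath[OF \<gamma>(1) s(1) t(1)] path_image_subpath_subset[OF s(1) t(1)] \<gamma>(2) by auto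
  then show "\<sigma> \<in> Cross0 (real m)"
    using \<sigma> s t unfolding Cross0_def space_percolation
    by (auto intro!: exI[of _ "subpath s t \<gamma>"])
qed

theorem corollary3p2:
  assumes "CARD('d::finite) \<ge> 2"
  shows "\<forall>\<eta>::real. \<eta> > 0 \<longrightarrow>
    Limsup at_top (\<lambda>R::real. ereal (R powr (real CARD('d) - 1 + \<eta>) *
      measure (percolation (p_c TYPE('d))) (Cross0 R :: ((real ^ 'd) set \<Rightarrow> nat) set))) > 0"
proof (intro allI impI)
  fix \<eta> :: real assume \<eta>: "\<eta> > 0"
  define d where "d = CARD('d)"
  have d: "d \<ge> 1"
    by (simp add: d_def Suc_le_eq)
  let ?p = "p_c TYPE('d)"
  let ?\<mu> = "\<lambda>R. measure (percolation ?p) (Cross0 R :: ((real ^ 'd) set \<Rightarrow> nat) set)"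
  let ?f = "\<lambda>R. R powr (real d - 1 + \<eta>) * ?\<mu> R"
  \<comment> \<open>Since \<open>2 * m + 1 \<le> 3 * m\<close> for \<open>m \<ge> 1\<close>, the
    boundary has at most \<open>m ^ (d - 1) / c\<close> vertices.\<close>
  define c where "c = 1 / (2 * real d * 3 ^ (d - 1))"
  have c: "c > 0"
    using d by (simp add: c_def)
  interpret prob_space "percolation ?p :: ((real ^ 'd) set \<Rightarrow> nat) measure"
    by (rule prob_space_percolation)
  have lower: "c \<le> ?f (real m)" if m: "m > 0" for m :: nat
  proof -
    let ?D = "2 * real d * 3 ^ (d - 1) * real m ^ (d - 1)"
    have "real (card (box_boundary m :: (real ^ 'd) set)) \<le> real (2 * d * (2 * m + 1) ^ (d - 1))"
      using card_box_boundary_le[of m, where 'd='d] unfolding d_def of_nat_le_iff .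
    also have "\<dots> \<le> real (2 * d * (3 * m) ^ (d - 1))"
      using m unfolding of_nat_le_iff by (intro mult_left_mono power_mono) auto
    also have "\<dots> = ?D"
      by (simp add: power_mult_distrib)
    finally have card: "real (card (box_boundary m :: (real ^ 'd) set)) \<le> ?D" .
    have "prob (arm_event ?p 0 m) \<le> ?\<mu> (real m)"
      by (intro finite_measure_mono arm_event_subset_Cross0 Cross0_sets p_c_bounds m)
    then have "arm_prob TYPE('d) ?p m \<le> ?\<mu> (real m)"
      by (simp add: measure_arm_event_0[OF p_c_bounds])
    with card have "real (card (box_boundary m :: (real ^ 'd) set)) * arm_prob TYPE('d) ?p m \<le> ?D * ?\<mu> (real m)"
      using arm_prob_nonneg[OF p_c_bounds] by (intro mult_mono) auto
    then have "1 \<le> ?D * ?\<mu> (real m)"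
      using critical_arm_prob_ge[OF m, where 'd='d] by linarith
    then have "c \<le> real m ^ (d - 1) * ?\<mu> (real m)"
      using d by (simp add: c_def field_simps)
    also have "\<dots> \<le> ?f (real m)"
    proof (intro mult_right_mono)
      have "real m ^ (d - 1) = real m powr (real d - 1)"
        using m d by (simp add: powr_realpow[symmetric])
      also have "\<dots> \<le> real m powr (real d - 1 + \<eta>)"
        using m \<eta> by (intro powr_mono) auto
      finally show "real m ^ (d - 1) \<le> real m powr (real d - 1 + \<eta>)" .
    qed simp
    finally show ?thesis .
  qed
  \<comment> \<open>A uniform bound along integer radii suffices: a smaller upper limit would push
    \<open>?f\<close> below \<open>c\<close> at all large real radii, integers included.\<close>
  have "ereal c \<le> Limsup at_top (\<lambda>R. ereal (?f R))"
  proof (rule ccontr)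
    assume "\<not> ?thesis"
    then have "\<forall>\<^sub>F R in at_top. ereal (?f R) < ereal c"
      by (intro Limsup_lessD) simp
    then have "\<forall>\<^sub>F m in sequentially. ereal (?f (real m)) < ereal c"
      using filterlim_real_sequentially by (rule eventually_compose_filterlim)
    then have "\<forall>\<^sub>F m in sequentially. False"
      using eventually_gt_at_top[of 0]
    proof eventually_elim
      case (elim m)
      with lower[of m] show False by simp
    qed
    then show False by simp
  qed
  with c show "Limsup at_top (\<lambda>R. ereal (R powr (real CARD('d) - 1 + \<eta>) * ?\<mu> R)) > 0"
    unfolding d_def by (meson ereal_less(2) less_le_trans)
qed

end
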